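(* Let $a\ge 2$ be an integer and let $\alpha$ be a real number with $0<\alpha<1$. Then there exist an infinite sequence $\omega=\omega_0\omega_1\omega_2\ldots$ over an $a$-letter alphabet and an integer $N$ such that for every finite set $X\subset\mathbb{N}$ with $\#X\ge N$ there exists $t\in X$ with $$K(X,\omega(X)\mid t)\ge \alpha\,\#X\log a .$$
   Context: $K(u\mid v)$ denotes conditional (prefix-free or plain) Kolmogorov complexity of a finite object $u$ given a finite object $v$ (finite sets of naturals, strings, integers and pairs of them are encoded as binary strings in a fixed computable way); $\log$ is the binary logarithm. For an infinite sequence $\omega$ and a finite set $X\subset\mathbb{N}$, $\omega(X)$ denotes the string of length $\#X$ formed by the letters $\omega_i$ with $i\in X$, taken in increasing order of $i$. *)

theory Defs
  imports "HOL-Library.Extended_Real" "HOL-Library.Nat_Bijection"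
    "HOL-Library.Sublist"
begin

text \<open>
  Kleene's partial recursive functions.  Programs carry no arity: a program computes a partial
  recursive function on the argument lists of each fixed length.  The counter of a primitive
  recursion and the variable of a minimization are the first argument.
\<close>

datatype recf = Zero | Succ | Proj nat | Comp recf "recf list" | PrimRec recf recf | Mu recf

inductive computes :: "recf \<Rightarrow> nat list \<Rightarrow> nat \<Rightarrow> bool" where
  zero: "computes Zero xs 0"
| succ: "computes Succ [x] (Suc x)"
| proj: "i < length xs \<Longrightarrow> computes (Proj i) xs (xs ! i)"
| comp: "list_all2 (\<lambda>g y. computes g xs y) gs ys \<Longrightarrow> computes f ys z \<Longrightarrow> computes (Comp f gs) xs z"
| primrec_0: "computes f xs y \<Longrightarrow> computes (PrimRec f g) (0 # xs) y"
| primrec_Suc: "computes (PrimRec f g) (n # xs) y \<Longrightarrow> computes g (n # y # xs) z \<Longrightarrow>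
    computes (PrimRec f g) (Suc n # xs) z"
| mu: "computes f (n # xs) 0 \<Longrightarrow> (\<forall>m<n. \<exists>y. computes f (m # xs) (Suc y)) \<Longrightarrow>
    computes (Mu f) xs n"

lemma computes_deterministic: "computes f xs y \<Longrightarrow> computes f xs z \<Longrightarrow> y = z"
proof (induction arbitrary: z rule: computes.induct)
  case (zero xs)
  then show ?case by cases simp
next
  case (succ x)
  then show ?case by cases simp
next
  case (proj i xs)
  from proj.prems show ?case by cases simp
next
  case (comp xs gs ys f z z')
  from comp.prems obtain ys' where
    ys': "list_all2 (\<lambda>g y. computes g xs y) gs ys'" "computes f ys' z'"
    by cases simp
  have "ys = ys'"
    using comp.IH(1) ys'(1) by (simp add: list_all2_conv_all_nth nth_equalityI)
  with comp.IH ys'(2) show ?case by simp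
next
  case (primrec_0 f xs y g)
  from primrec_0.prems have "computes f xs z" by cases simp
  with primrec_0.IH show ?case by simp
next
  case (primrec_Suc f g n xs y z z')
  from primrec_Suc.prems obtain y' where
    "computes (PrimRec f g) (n # xs) y'" "computes g (n # y' # xs) z'"
    by cases simp
  with primrec_Suc.IH show ?case by simp
next
  case (mu f n xs z)
  from mu.prems have z: "computes f (z # xs) 0" "\<forall>m<z. \<exists>y. computes f (m # xs) (Suc y)"
    by (cases, simp)+
  show ?case
  proof (cases n z rule: linorder_cases)
    case less
    with z(2) obtain y where "computes f (n # xs) (Suc y)" by blast
    with mu.IH(1) show ?thesis by blast
  next
    case greater
    with mu.IH(2) z(1) show ?thesis by blast
  qed simp
qed

text \<open>Binary strings and natural numbers are identified by bijective base-2 numeration.\<close>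

fun string_code :: "bool list \<Rightarrow> nat" where
  "string_code [] = 0"
| "string_code (b # bs) = (if b then 2 else 1) + 2 * string_code bs"

lemma bij_string_code: "bij string_code"
proof (rule bijI)
  have "string_code xs = string_code ys \<Longrightarrow> xs = ys" for xs ys
  proof (induction xs arbitrary: ys)
    case Nil
    then show ?case by (cases ys) (auto split: if_splits)
  next
    case (Cons b bs)
    then obtain c cs where ys: "ys = c # cs" by (cases ys) (auto split: if_splits)
    with Cons.prems have "b = c \<and> string_code bs = string_code cs"
      by (cases b; cases c; simp; presburger)
    with Cons.IH ys show ?case by simp
  qed
  then show "inj string_code" by (rule injI)
  have "\<exists>bs. string_code bs = n" for n
  proof (induction n rule: less_induct)
    case (less n)
    show ?case
    proof (cases "n = 0")
      case True
      then have "string_code [] = n" by simp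
      then show ?thesis ..
    next
      case False
      then have "(n - 1) div 2 < n" by linarith
      with less obtain bs where "string_code bs = (n - 1) div 2" by blast
      with False have "string_code (even n # bs) = n" by (cases "even n") (auto elim!: evenE oddE)
      then show ?thesis ..
    qed
  qed
  then show "surj string_code" by (metis surjI)
qed

definition string_of_nat :: "nat \<Rightarrow> bool list" where
  "string_of_nat = inv string_code"

text \<open>A decompressor maps a program and a condition to an output, and may diverge.\<close>

type_synonym decompressor = "bool list \<Rightarrow> bool list \<Rightarrow> bool list option"

definition partial_computable :: "decompressor \<Rightarrow> bool" where
  "partial_computable D \<longleftrightarrow> (\<exists>f. \<forall>p v y.
     computes f [string_code p, string_code v] y \<longleftrightarrow> map_option string_code (D p v) = Some y)"

definition prefix_free :: "decompressor \<Rightarrow> bool" where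
  "prefix_free D \<longleftrightarrow> (\<forall>p q v. D p v \<noteq> None \<and> D q v \<noteq> None \<and> prefix p q \<longrightarrow> p = q)"

text \<open>The infimum of the empty set is \<open>\<infinity>\<close>.\<close>

definition complexity :: "decompressor \<Rightarrow> bool list \<Rightarrow> bool list \<Rightarrow> enat" where
  "complexity D u v = (INF p \<in> {p. D p v = Some u}. enat (length p))"

definition optimal_in :: "decompressor set \<Rightarrow> decompressor \<Rightarrow> bool" where
  "optimal_in \<D> D \<longleftrightarrow> D \<in> \<D> \<and>
     (\<forall>D'\<in>\<D>. \<exists>c. \<forall>u v. complexity D u v \<le> complexity D' u v + enat c)"

text \<open>
  Kolmogorov complexity is \<^term>\<open>complexity D\<close> for an optimal \<open>D\<close>, which determines it up to an
  additive constant.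
\<close>

definition optimal_plain :: "decompressor \<Rightarrow> bool" where
  "optimal_plain = optimal_in {D. partial_computable D}"

definition optimal_prefix_free :: "decompressor \<Rightarrow> bool" where
  "optimal_prefix_free = optimal_in {D. partial_computable D \<and> prefix_free D}"

definition subword :: "(nat \<Rightarrow> nat) \<Rightarrow> nat set \<Rightarrow> nat list" where
  "subword \<omega> X = map \<omega> (sorted_list_of_set X)"

definition encode_set_word :: "nat set \<Rightarrow> nat list \<Rightarrow> bool list" where
  "encode_set_word X w = string_of_nat (prod_encode (set_encode X, list_encode w))"

end

theory Submission
  imports Defs "HOL-Library.FuncSet" Complex_Main
begin

text \<open>
  For every \<open>t\<close> there are at most \<open>2 * a powr (\<alpha> * m)\<close> pairs \<open>(X, w)\<close> with \<open>card X = m\<close> whose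
  complexity given \<open>t\<close> is below \<open>\<alpha> * m * log 2 a\<close>. A sequence that avoids all pairs \<open>(X, w)\<close> that
  are simple given every \<open>t \<in> X\<close> is found by counting, in place of the Lovasz local lemma. With
  \<open>\<beta> = a powr \<gamma>\<close> and \<open>\<alpha> < \<gamma> < 1\<close>, each new position multiplies the number of avoiding colourings
  of a finite set \<open>S\<close> by at least \<open>\<beta>\<close>: an extension spoiled by a pattern on \<open>m\<close> positions is
  determined by an avoiding colouring of the other positions, and by induction the number of these
  is at most \<open>\<beta> powr (1 - m)\<close> times the number of avoiding colourings of \<open>S\<close>. Compactness then
  gives an infinite sequence.
\<close>

section \<open>Counting colourings that avoid patterns\<close>

text \<open>Extensional functions make a colouring of \<open>S\<close> a single object, so that
  colourings can be counted by \<open>card\<close> and matching a pattern is an equation between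
  restrictions.\<close>

definition avoiding :: "('v set \<times> ('v \<Rightarrow> 'c)) set \<Rightarrow> 'c set \<Rightarrow> 'v set \<Rightarrow> ('v \<Rightarrow> 'c) set" where
  "avoiding B A S = {f \<in> S \<rightarrow>\<^sub>E A. \<forall>(X, g) \<in> B. X \<subseteq> S \<longrightarrow> restrict f X \<noteq> g}"

lemma finite_avoiding: "finite S \<Longrightarrow> finite A \<Longrightarrow> finite (avoiding B A S)"
  by (rule finite_subset[OF _ finite_PiE[of S "\<lambda>_. A"]]) (auto simp: avoiding_def)

lemma restrict_avoiding:
  assumes "f \<in> avoiding B A S" "T \<subseteq> S"
  shows "restrict f T \<in> avoiding B A T"
proof -
  have "restrict f T \<in> T \<rightarrow>\<^sub>E A"
    using assms by (auto simp: avoiding_def)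
  moreover have "restrict (restrict f T) X \<noteq> g" if "(X, g) \<in> B" "X \<subseteq> T" for X g
  proof -
    have "restrict (restrict f T) X = restrict f X"
      using that by (simp add: Int_absorb1)
    moreover have "X \<subseteq> S" using that assms(2) by auto
    ultimately show ?thesis using that(1) assms(1) by (auto simp: avoiding_def)
  qed
  ultimately show ?thesis by (auto simp: avoiding_def)
qed

lemma card_extensions:
  assumes "v \<notin> S" "G \<subseteq> S \<rightarrow>\<^sub>E A"
  shows "card {f \<in> insert v S \<rightarrow>\<^sub>E A. restrict f S \<in> G} = card A * card G"
proof -
  have res: "restrict (h(v := c)) S = h" if "h \<in> G" for h c
    using that assms by (metis PiE_restrict restrict_fupd subsetD)
  have upd: "(restrict f S)(v := f v) = f" if "f \<in> insert v S \<rightarrow>\<^sub>E A" for f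
    using PiE_arb[OF that] by (intro ext) simp
  have mem: "h(v := c) \<in> insert v S \<rightarrow>\<^sub>E A" if "h \<in> G" "c \<in> A" for h c
    using that assms(2) by (intro PiE_fun_upd) auto
  have "bij_betw (\<lambda>(c, h). h(v := c)) (A \<times> G) {f \<in> insert v S \<rightarrow>\<^sub>E A. restrict f S \<in> G}"
  proof (rule bij_betw_byWitness[where f' = "\<lambda>f. (f v, restrict f S)"])
    show "(\<lambda>(c, h). h(v := c)) ` (A \<times> G) \<subseteq> {f \<in> insert v S \<rightarrow>\<^sub>E A. restrict f S \<in> G}"
      using res mem by force
  qed (use res upd in \<open>auto simp del: restrict_fupd\<close>)
  from bij_betw_same_card[OF this] show ?thesis
    by (simp add: card_cartesian_product)
qed

text \<open>The weight \<open>\<beta> / \<beta> ^ card X\<close> bounds the number of extensions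
  spoiled by one pattern through \<open>v\<close>, relative to the number of avoiding colourings of
  \<open>S\<close>. Each of these has \<open>card A\<close> extensions, so a total weight of at most
  \<open>card A - \<beta>\<close> leaves \<open>\<beta>\<close> of them on average. The bound
  \<open>T\<close> keeps the sum over finitely many patterns.\<close>

lemma avoiding_growth:
  fixes \<beta> :: real
  assumes "finite A" "\<beta> > 0"
    and pat: "\<And>X g. (X, g) \<in> B \<Longrightarrow> g \<in> X \<rightarrow>\<^sub>E A"
    and weight: "\<And>v T. finite T \<Longrightarrow>
      (\<Sum>p\<in>{p \<in> B. v \<in> fst p \<and> fst p \<subseteq> T}. \<beta> / \<beta> ^ card (fst p)) \<le> real (card A) - \<beta>"
    and "finite S" "v \<notin> S"
  shows "\<beta> * card (avoiding B A S) \<le> card (avoiding B A (insert v S))"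
  using \<open>finite S\<close> \<open>v \<notin> S\<close>
proof (induction S arbitrary: v rule: finite_psubset_induct)
  case (psubset S)
  let ?G = "avoiding B A"
  \<comment> \<open>The induction hypothesis is iterated, adding the points of \<open>U\<close> one
    at a time. Before each addition the set is a proper subset of \<open>S\<close>, and the added
    point varies, hence \<open>v\<close> is arbitrary in the induction.\<close>
  have mono: "\<beta> ^ card U * card (?G T) \<le> card (?G (T \<union> U))"
    if "T \<union> U \<subseteq> S" "T \<inter> U = {}" for T U
  proof -
    have "finite U" using that psubset.hyps by (auto intro: finite_subset)
    then show ?thesis using that
    proof (induction U)
      case (insert u U)
      then have "T \<union> U \<subset> S" "u \<notin> T \<union> U" by auto
      then have *: "\<beta> * card (?G (T \<union> U)) \<le> card (?G (insert u (T \<union> U)))"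
        using psubset.IH by blast
      have "\<beta> ^ card U * card (?G T) \<le> card (?G (T \<union> U))"
        using insert by auto
      then have "\<beta> * (\<beta> ^ card U * card (?G T)) \<le> \<beta> * card (?G (T \<union> U))"
        using \<open>\<beta> > 0\<close> by simp
      with * insert.hyps show ?case by (simp add: mult.assoc)
    qed simp
  qed
  \<comment> \<open>\<open>P\<close> collects the patterns that can newly occur once
    \<open>v\<close> is added, \<open>E\<close> all extensions of avoiding colourings, and
    \<open>F p\<close> those spoiled by \<open>p\<close>.\<close>
  define P where "P = {p \<in> B. v \<in> fst p \<and> fst p \<subseteq> insert v S}"
  define E where "E = {f \<in> insert v S \<rightarrow>\<^sub>E A. restrict f S \<in> ?G S}"
  define F where "F p = {f \<in> E. restrict f (fst p) = snd p}" for p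
  have "P \<subseteq> (SIGMA X:Pow (insert v S). X \<rightarrow>\<^sub>E A)"
    using pat by (force simp: P_def)
  moreover have "finite (SIGMA X:Pow (insert v S). X \<rightarrow>\<^sub>E A)"
    using psubset.hyps \<open>finite A\<close> by (intro finite_SigmaI finite_PiE) (auto intro: finite_subset)
  ultimately have finP: "finite P" by (rule finite_subset)
  have finE: "finite E"
    using psubset.hyps \<open>finite A\<close>
    by (auto simp: E_def intro!: finite_subset[OF _ finite_PiE[of "insert v S" "\<lambda>_. A"]])
  have cardE: "card E = card A * card (?G S)"
    unfolding E_def using psubset.prems
    by (intro card_extensions) (auto simp: avoiding_def)
  have cover: "E \<subseteq> ?G (insert v S) \<union> (\<Union>p\<in>P. F p)"
  proof
    fix f assume f: "f \<in> E"
    show "f \<in> ?G (insert v S) \<union> (\<Union>p\<in>P. F p)"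
    proof (cases "f \<in> ?G (insert v S)")
      case False
      with f obtain X g where Xg: "(X, g) \<in> B" "X \<subseteq> insert v S" "restrict f X = g"
        by (auto simp: E_def avoiding_def)
      \<comment> \<open>A pattern missing \<open>v\<close> would lie inside \<open>S\<close>, where
        the restriction of \<open>f\<close> already avoids it.\<close>
      have "v \<in> X"
      proof (rule ccontr)
        assume "v \<notin> X"
        with Xg have "X \<subseteq> S" by auto
        then have "restrict (restrict f S) X = g"
          using Xg by (simp add: Int_absorb1)
        with f \<open>X \<subseteq> S\<close> Xg(1) show False by (auto simp: E_def avoiding_def)
      qed
      with Xg f have "(X, g) \<in> P" "f \<in> F (X, g)" by (auto simp: P_def F_def)
      then show ?thesis by blast
    qed simp
  qed
  have cardF: "card (F p) \<le> \<beta> / \<beta> ^ card (fst p) * card (?G S)" if "p \<in> P" for p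
  proof -
    obtain X g where p: "p = (X, g)" by fastforce
    with that have X: "v \<in> X" "X \<subseteq> insert v S" by (auto simp: P_def)
    \<comment> \<open>A member of \<open>F p\<close> is prescribed on \<open>X\<close>, which
      contains \<open>v\<close>, so its values on \<open>S - X\<close> determine it.\<close>
    have "inj_on (\<lambda>f. restrict f (S - X)) (F p)"
    proof (rule inj_onI)
      fix f f' assume f: "f \<in> F p" "f' \<in> F p" "restrict f (S - X) = restrict f' (S - X)"
      show "f = f'"
      proof
        fix x
        consider "x \<in> X" | "x \<in> S - X" | "x \<notin> insert v S" using X by auto
        then show "f x = f' x"
        proof cases
          case 1
          from f have "restrict f X = restrict f' X" by (auto simp: F_def p)
          with 1 show ?thesis by (metis restrict_apply')
        next
          case 2
          with f show ?thesis by (metis restrict_apply')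
        next
          case 3
          with f show ?thesis by (auto simp: F_def E_def PiE_iff extensional_def)
        qed
      qed
    qed
    moreover have "(\<lambda>f. restrict f (S - X)) ` F p \<subseteq> ?G (S - X)"
    proof clarify
      fix f assume "f \<in> F p"
      then have "restrict f S \<in> ?G S" by (simp add: F_def E_def)
      then have "restrict (restrict f S) (S - X) \<in> ?G (S - X)"
        by (rule restrict_avoiding) auto
      moreover have "restrict (restrict f S) (S - X) = restrict f (S - X)"
        by (simp add: Int_absorb1)
      ultimately show "restrict f (S - X) \<in> ?G (S - X)" by simp
    qed
    ultimately have "card (F p) \<le> card (?G (S - X))"
      using psubset.hyps \<open>finite A\<close> by (intro card_inj_on_le[of "\<lambda>f. restrict f (S - X)"] finite_avoiding) auto
    \<comment> \<open>Passing from \<open>S - X\<close> back to \<open>S\<close> adds only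
      \<open>card X - 1\<close> points, as \<open>v\<close> is outside \<open>S\<close>; this gives
      the exponent of the weight.\<close>
    moreover have "\<beta> ^ card (X \<inter> S) * card (?G (S - X)) \<le> card (?G S)"
      using mono[of "S - X" "X \<inter> S"] by (auto simp: Un_commute Int_commute Un_Diff_Int)
    moreover have "card X = Suc (card (X \<inter> S))"
    proof -
      have "X = insert v (X \<inter> S)" using X by auto
      moreover have "card (insert v (X \<inter> S)) = Suc (card (X \<inter> S))"
        using psubset.hyps psubset.prems by simp
      ultimately show ?thesis by simp
    qed
    ultimately have "\<beta> ^ card (X \<inter> S) * card (F p) \<le> card (?G S)"
      using \<open>\<beta> > 0\<close> by (smt (verit) mult_left_mono of_nat_le_iff zero_le_power)
    with \<open>\<beta> > 0\<close> \<open>card X = _\<close> show ?thesis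
      by (simp add: p field_simps)
  qed
  have "card E \<le> card (?G (insert v S)) + (\<Sum>p\<in>P. card (F p))"
  proof -
    have "card E \<le> card (?G (insert v S) \<union> (\<Union>p\<in>P. F p))"
      using psubset.hyps \<open>finite A\<close> finP finE
      by (intro card_mono cover) (auto simp: F_def intro: finite_avoiding)
    also have "\<dots> \<le> card (?G (insert v S)) + card (\<Union>p\<in>P. F p)" by (rule card_Un_le)
    also have "card (\<Union>p\<in>P. F p) \<le> (\<Sum>p\<in>P. card (F p))" using finP by (rule card_UN_le)
    finally show ?thesis by simp
  qed
  then have "real (card A) * card (?G S) \<le> card (?G (insert v S)) + (\<Sum>p\<in>P. real (card (F p)))"
    unfolding cardE by (metis of_nat_add of_nat_le_iff of_nat_mult of_nat_sum)
  also have "(\<Sum>p\<in>P. real (card (F p))) \<le> (\<Sum>p\<in>P. \<beta> / \<beta> ^ card (fst p)) * card (?G S)"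
    unfolding sum_distrib_right by (intro sum_mono cardF)
  also have "\<dots> \<le> (real (card A) - \<beta>) * card (?G S)"
    unfolding P_def using psubset.hyps by (intro mult_right_mono weight) auto
  finally show ?case by (simp add: algebra_simps)
qed

lemma avoiding_nonempty:
  fixes \<beta> :: real
  assumes "finite A" "\<beta> > 0"
    and "\<And>X g. (X, g) \<in> B \<Longrightarrow> X \<noteq> {} \<and> g \<in> X \<rightarrow>\<^sub>E A"
    and "\<And>v T. finite T \<Longrightarrow>
      (\<Sum>p\<in>{p \<in> B. v \<in> fst p \<and> fst p \<subseteq> T}. \<beta> / \<beta> ^ card (fst p)) \<le> real (card A) - \<beta>"
    and "finite S"
  shows "avoiding B A S \<noteq> {}"
  using \<open>finite S\<close>
proof (induction S)
  case empty
  \<comment> \<open>The empty colouring survives because every pattern has a nonempty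
    domain.\<close>
  have "(\<lambda>_. undefined) \<in> avoiding B A {}"
    using assms(3) by (auto simp: avoiding_def)
  then show ?case by blast
next
  case (insert v S)
  then have "card (avoiding B A S) > 0"
    using finite_avoiding[OF insert.hyps(1) assms(1)] by (simp add: card_gt_0_iff)
  then have "0 < \<beta> * card (avoiding B A S)" using \<open>\<beta> > 0\<close> by simp
  also have "\<dots> \<le> card (avoiding B A (insert v S))"
    using assms insert.hyps by (intro avoiding_growth) auto
  finally show ?case by auto
qed

section \<open>Compactness: from finite colourings to an infinite sequence\<close>

text \<open>Koenig's lemma: letters are fixed one by one so that infinitely many of the finite
  witnesses agree with the prefix chosen so far, which is possible over a finite alphabet by the
  pigeonhole principle.\<close>

lemma sequence_compactness:
  fixes G :: "nat \<Rightarrow> (nat \<Rightarrow> 'c) \<Rightarrow> bool"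
  assumes "finite A"
    and ex: "\<And>n. \<exists>f. (\<forall>i<n. f i \<in> A) \<and> G n f"
    and anti: "\<And>m n f. m \<le> n \<Longrightarrow> G n f \<Longrightarrow> G m f"
    and local: "\<And>n f g. G n f \<Longrightarrow> (\<And>i. i < n \<Longrightarrow> f i = g i) \<Longrightarrow> G n g"
  shows "\<exists>f. (\<forall>i. f i \<in> A) \<and> (\<forall>n. G n f)"
proof -
  obtain F where F: "\<And>n i. i < n \<Longrightarrow> F n i \<in> A" "\<And>n. G n (F n)"
    using ex by metis
  define P where "P k h \<longleftrightarrow> infinite {n. \<forall>i<k. F n i = h i}" for k and h :: "nat \<Rightarrow> 'c"
  have "\<exists>h. \<forall>k. P k (h k) \<and> (\<forall>i<k. h (Suc k) i = h k i)"
  proof (rule dependent_nat_choice)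
    show "\<exists>h. P 0 h" by (simp add: P_def)
  next
    fix h k assume "P k h"
    \<comment> \<open>Removing the indices up to \<open>k\<close> ensures \<open>k < n\<close>, so
      that the letter \<open>F n k\<close> lies in \<open>A\<close>.\<close>
    define I where "I = {n. \<forall>i<k. F n i = h i} - {..k}"
    have I: "infinite I" using \<open>P k h\<close> by (simp add: P_def I_def)
    have "(\<lambda>n. F n k) ` I \<subseteq> A" using F(1) by (force simp: I_def)
    then have "finite ((\<lambda>n. F n k) ` I)" using \<open>finite A\<close> by (rule finite_subset)
    then obtain m where m: "m \<in> I" "infinite {n \<in> I. F n k = F m k}"
      using pigeonhole_infinite[OF I] by blast
    have "{n \<in> I. F n k = F m k} \<subseteq> {n. \<forall>i<Suc k. F n i = (h(k := F m k)) i}"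
      by (auto simp: I_def less_Suc_eq)
    with m have "P (Suc k) (h(k := F m k))"
      unfolding P_def by (meson infinite_super)
    then show "\<exists>h'. P (Suc k) h' \<and> (\<forall>i<k. h' i = h i)" by force
  qed
  then obtain h where h: "\<And>k. P k (h k)" "\<And>k i. i < k \<Longrightarrow> h (Suc k) i = h k i" by blast
  \<comment> \<open>Diagonal sequence: the letter at \<open>i\<close> no longer changes from stage
    \<open>Suc i\<close> on.\<close>
  define w where "w i = h (Suc i) i" for i
  have agree: "h k i = w i" if "i < k" for i k
    using that by (induction k) (auto simp: w_def less_Suc_eq h(2))
  have approx: "\<exists>n\<ge>k. \<forall>i<k. F n i = w i" for k
  proof -
    have "infinite {n. \<forall>i<k. F n i = h k i}" using h(1) by (simp add: P_def)
    then obtain n where "n \<ge> k" "\<forall>i<k. F n i = h k i"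
      unfolding infinite_nat_iff_unbounded_le by blast
    with agree show ?thesis by auto
  qed
  have "w i \<in> A" for i
  proof -
    obtain n where "n \<ge> Suc i" "F n i = w i" using approx[of "Suc i"] by auto
    with F(1) show ?thesis by (metis Suc_le_lessD)
  qed
  moreover have "G k w" for k
  proof -
    obtain n where "n \<ge> k" "\<And>i. i < k \<Longrightarrow> F n i = w i" using approx[of k] by auto
    with F(2) anti local show ?thesis by metis
  qed
  ultimately show ?thesis by blast
qed

lemma avoiding_sequence:
  fixes \<beta> :: real and B :: "(nat set \<times> (nat \<Rightarrow> 'c)) set"
  assumes "finite A" "\<beta> > 0"
    and "\<And>X g. (X, g) \<in> B \<Longrightarrow> X \<noteq> {} \<and> g \<in> X \<rightarrow>\<^sub>E A"
    and "\<And>v T. finite T \<Longrightarrow>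
      (\<Sum>p\<in>{p \<in> B. v \<in> fst p \<and> fst p \<subseteq> T}. \<beta> / \<beta> ^ card (fst p)) \<le> real (card A) - \<beta>"
  shows "\<exists>\<omega>. (\<forall>i. \<omega> i \<in> A) \<and> (\<forall>X. finite X \<longrightarrow> (X, restrict \<omega> X) \<notin> B)"
proof -
  let ?G = "\<lambda>n f. \<forall>X\<subseteq>{..<n}. (X, restrict f X) \<notin> B"
  have "\<exists>\<omega>. (\<forall>i. \<omega> i \<in> A) \<and> (\<forall>n. ?G n \<omega>)"
  proof (rule sequence_compactness)
    fix n
    obtain f where "f \<in> avoiding B A {..<n}"
      using avoiding_nonempty[OF assms, of "{..<n}"] by auto
    then show "\<exists>f. (\<forall>i<n. f i \<in> A) \<and> ?G n f"
      by (intro exI[of _ f]) (auto simp: avoiding_def PiE_iff)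
  next
    fix m n :: nat and f assume "m \<le> n" "?G n f"
    then show "?G m f" by (meson lessThan_subset_iff order_trans)
  next
    fix n and f g :: "nat \<Rightarrow> 'c"
    assume f: "?G n f" and fg: "\<And>i. i < n \<Longrightarrow> f i = g i"
    have "restrict f X = restrict g X" if "X \<subseteq> {..<n}" for X
      using that fg by (intro restrict_ext) auto
    with f show "?G n g" by metis
  qed (fact \<open>finite A\<close>)
  \<comment> \<open>Every finite \<open>X\<close> lies in some initial segment.\<close>
  then show ?thesis by (metis finite_nat_iff_bounded)
qed

section \<open>Encoding of patterns and counting of simple objects\<close>

lemma subword_restrict: "finite X \<Longrightarrow> subword (restrict f X) X = subword f X"
  by (simp add: subword_def)

text \<open>The code yields the finite set \<open>X\<close>, then the word lists the values of
  \<open>g\<close> along \<open>X\<close> in increasing order, and extensionality fixes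
  \<open>g\<close> elsewhere. Thus counting simple strings bounds the number of simple
  patterns.\<close>

lemma inj_on_encode_pattern:
  "inj_on (\<lambda>(X, g). encode_set_word X (subword g X)) (SIGMA X:Collect finite. X \<rightarrow>\<^sub>E A)"
proof (rule inj_onI, clarify)
  fix X g Y h
  assume X: "finite X" "g \<in> X \<rightarrow>\<^sub>E A" and Y: "finite Y" "h \<in> Y \<rightarrow>\<^sub>E A"
    and eq: "encode_set_word X (subword g X) = encode_set_word Y (subword h Y)"
  have "inj string_of_nat"
    unfolding string_of_nat_def using bij_string_code by (simp add: bij_imp_bij_inv bij_is_inj)
  with eq have *: "set_encode X = set_encode Y" "subword g X = subword h Y"
    by (auto simp: encode_set_word_def inj_eq list_encode_eq)
  with X Y have "X = Y" by (simp add: set_encode_eq)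
  with *(2) X(1) have "\<forall>x\<in>X. g x = h x" by (auto simp: subword_def)
  with X Y \<open>X = Y\<close> show "X = Y \<and> g = h" by (auto intro: PiE_ext)
qed

lemma card_short_strings:
  assumes "r > 0"
  shows "finite {p :: bool list. real (length p) < r}"
    and "card {p :: bool list. real (length p) < r} \<le> 2 * 2 powr r"
proof -
  \<comment> \<open>The largest integer strictly below \<open>r\<close>, a natural number since
    \<open>r > 0\<close>.\<close>
  define L where "L = nat \<lceil>r\<rceil> - 1"
  have L: "real L < r" using assms unfolding L_def by linarith
  have sub: "{p :: bool list. real (length p) < r} \<subseteq> {p. set p \<subseteq> UNIV \<and> length p \<le> L}"
    unfolding L_def by (auto; linarith)
  have fin: "finite {p :: bool list. set p \<subseteq> UNIV \<and> length p \<le> L}"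
    by (rule finite_lists_length_le) simp
  show "finite {p :: bool list. real (length p) < r}"
    using finite_subset[OF sub fin] .
  have "card {p :: bool list. set p \<subseteq> UNIV \<and> length p \<le> L} = (\<Sum>i\<le>L. 2 ^ i)"
    by (subst card_lists_length_le) auto
  also have "\<dots> \<le> 2 * 2 ^ L"
    by (induction L) auto
  finally have "card {p :: bool list. real (length p) < r} \<le> 2 * 2 ^ L"
    using card_mono[OF fin sub] by linarith
  then have "real (card {p :: bool list. real (length p) < r}) \<le> 2 * 2 ^ L"
    by (metis (mono_tags, lifting) of_nat_le_iff of_nat_mult of_nat_numeral of_nat_power)
  also have "\<dots> \<le> 2 * 2 powr r"
    using L by (simp add: powr_realpow[symmetric])
  finally show "card {p :: bool list. real (length p) < r} \<le> 2 * 2 powr r" .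
qed

lemma complexity_less_imp_program:
  assumes "ereal_of_enat (complexity D u v) < ereal r"
  shows "\<exists>p. D p v = Some u \<and> real (length p) < r"
proof -
  from assms obtain k where k: "complexity D u v = enat k" "real k < r"
    by (cases "complexity D u v") auto
  \<comment> \<open>A strict bound on the infimum yields an actual program; \<open>Suc k\<close>
    makes its length at most \<open>k\<close>.\<close>
  then have "complexity D u v < enat (Suc k)" by simp
  then obtain p where "D p v = Some u" "length p < Suc k"
    unfolding complexity_def INF_less_iff by auto
  with k show ?thesis by (intro exI[of _ p]) auto
qed

text \<open>For a fixed condition a program has at most one output, so there are no more such
  outputs than programs shorter than \<open>r\<close>.\<close>

lemma card_simple_outputs:
  assumes "r > 0"
  shows "finite {u. ereal_of_enat (complexity D u v) < ereal r}"
    and "card {u. ereal_of_enat (complexity D u v) < ereal r} \<le> 2 * 2 powr r"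
proof -
  let ?P = "{p :: bool list. real (length p) < r}"
  have sub: "{u. ereal_of_enat (complexity D u v) < ereal r} \<subseteq> (\<lambda>p. the (D p v)) ` ?P"
  proof
    fix u assume "u \<in> {u. ereal_of_enat (complexity D u v) < ereal r}"
    then obtain p where "D p v = Some u" "p \<in> ?P"
      using complexity_less_imp_program by blast
    then show "u \<in> (\<lambda>p. the (D p v)) ` ?P" by force
  qed
  note fin = card_short_strings(1)[OF assms]
  from sub fin show "finite {u. ereal_of_enat (complexity D u v) < ereal r}"
    by (meson finite_imageI finite_subset)
  have "card {u. ereal_of_enat (complexity D u v) < ereal r} \<le> card ?P"
    using surj_card_le[OF fin sub] .
  with card_short_strings(2)[OF assms]
  show "card {u. ereal_of_enat (complexity D u v) < ereal r} \<le> 2 * 2 powr r" by linarith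
qed

section \<open>Total weight of the patterns through one position\<close>

lemma sum_power_tail_le:
  fixes q :: real
  assumes "0 < q" "q < 1"
  shows "(\<Sum>m=N..<M. q ^ m) \<le> q ^ N / (1 - q)"
proof (cases "N \<le> M")
  case True
  have "(1 - q) * (\<Sum>m=N..<M. q ^ m) = q ^ N - q ^ M"
    using True by (induction rule: dec_induct) (simp_all add: sum.atLeastLessThan_Suc distrib_left left_diff_distrib)
  then have "(\<Sum>m=N..<M. q ^ m) = (q ^ N - q ^ M) / (1 - q)"
    using assms by (simp add: field_simps)
  also have "\<dots> \<le> q ^ N / (1 - q)"
    using assms by (intro divide_right_mono) auto
  finally show ?thesis .
qed (use assms in auto)

text \<open>Grouped by size, the at most \<open>c * (q * \<beta>) ^ m\<close> patterns of size
  \<open>m\<close> contribute at most \<open>\<beta> * c * q ^ m\<close>, which leaves a geometric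
  tail starting at \<open>N\<close>.\<close>

lemma pattern_weight_le:
  fixes \<beta> c q :: real
  assumes "\<beta> > 0" "c \<ge> 0" "0 < q" "q < 1" "finite T"
    and large: "\<And>p. p \<in> P \<Longrightarrow> N \<le> card (fst p) \<and> fst p \<subseteq> T"
    and fin: "\<And>m. m \<ge> N \<Longrightarrow> finite {p \<in> P. card (fst p) = m}"
    and count: "\<And>m. m \<ge> N \<Longrightarrow> card {p \<in> P. card (fst p) = m} \<le> c * (q * \<beta>) ^ m"
  shows "(\<Sum>p\<in>P. \<beta> / \<beta> ^ card (fst p)) \<le> \<beta> * c * (q ^ N / (1 - q))"
proof -
  let ?M = "{N..<Suc (card T)}" and ?P = "\<lambda>m. {p \<in> P. card (fst p) = m}"
  have P: "P = (\<Union>m\<in>?M. ?P m)"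
    using large \<open>finite T\<close> by (auto simp: less_Suc_eq_le card_mono)
  then have finP: "finite P"
    by (metis (no_types, lifting) atLeastLessThan_iff fin finite_UN_I finite_atLeastLessThan)
  have "(\<Sum>p\<in>P. \<beta> / \<beta> ^ card (fst p)) = (\<Sum>m\<in>?M. \<Sum>p\<in>?P m. \<beta> / \<beta> ^ card (fst p))"
    using P by (intro sum.group[symmetric] finP) auto
  also have "\<dots> = (\<Sum>m\<in>?M. card (?P m) * (\<beta> / \<beta> ^ m))"
    by (intro sum.cong) auto
  also have "\<dots> \<le> (\<Sum>m\<in>?M. c * (q * \<beta>) ^ m * (\<beta> / \<beta> ^ m))"
    using \<open>\<beta> > 0\<close> by (intro sum_mono mult_right_mono count) auto
  also have "\<dots> = \<beta> * c * (\<Sum>m\<in>?M. q ^ m)"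
    unfolding sum_distrib_left using \<open>\<beta> > 0\<close>
    by (intro sum.cong) (auto simp: power_mult_distrib field_simps)
  also have "\<dots> \<le> \<beta> * c * (q ^ N / (1 - q))"
    using assms by (intro mult_left_mono sum_power_tail_le) auto
  finally show ?thesis .
qed

section \<open>Choice of parameters and conclusion\<close>

theorem theorem2:
  fixes a :: nat and \<alpha> :: real and K :: "bool list \<Rightarrow> bool list \<Rightarrow> enat"
  assumes "a \<ge> 2" and "0 < \<alpha>" and "\<alpha> < 1"
    and "\<exists>D. (optimal_plain D \<or> optimal_prefix_free D) \<and> K = complexity D"
  shows "\<exists>(\<omega> :: nat \<Rightarrow> nat) (N :: nat). (\<forall>i. \<omega> i < a) \<and>
    (\<forall>X. finite X \<and> card X \<ge> N \<longrightarrow>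
      (\<exists>t\<in>X. ereal_of_enat (K (encode_set_word X (subword \<omega> X)) (string_of_nat t))
        \<ge> ereal (\<alpha> * real (card X) * log 2 (real a))))"
proof -
  obtain D where K: "K = complexity D" using assms(4) by blast
  \<comment> \<open>The midpoint of \<alpha> and 1: \<gamma> < 1 gives \<open>\<beta> < a\<close>,
    and \<alpha> < \<gamma> gives \<open>q < 1\<close>. The product \<open>q * \<beta>\<close> is
    \<open>a powr \<alpha>\<close>, the growth rate of the number of simple patterns.\<close>
  define \<gamma> where "\<gamma> = (1 + \<alpha>) / 2"
  define \<beta> where "\<beta> = real a powr \<gamma>"
  define q where "q = real a powr (\<alpha> - \<gamma>)"
  have \<beta>: "0 < \<beta>" "\<beta> < a"
    using assms(1,3) powr_less_mono[of \<gamma> 1 "real a"] by (auto simp: \<beta>_def \<gamma>_def)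
  have q: "0 < q" "q < 1"
    using assms(1,3) powr_less_mono[of "\<alpha> - \<gamma>" 0 "real a"] by (auto simp: q_def \<gamma>_def)
  have q\<beta>: "q * \<beta> = a powr \<alpha>"
    by (simp add: q_def \<beta>_def powr_add[symmetric])
  \<comment> \<open>The tail vanishes, so a large \<open>N\<close> brings the weight below the
    positive slack \<open>a - \<beta>\<close>. Also \<open>N \<ge> 1\<close> keeps pattern domains
    nonempty and \<open>r m\<close> positive.\<close>
  have "(\<lambda>n. \<beta> * 2 * (q ^ n / (1 - q))) \<longlonglongrightarrow> \<beta> * 2 * (0 / (1 - q))"
    using q by (intro tendsto_intros LIMSEQ_power_zero) auto
  then have "\<forall>\<^sub>F n in sequentially. \<beta> * 2 * (q ^ n / (1 - q)) < a - \<beta>"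
    using \<beta> by (intro order_tendstoD(2)) auto
  then have "\<forall>\<^sub>F n in sequentially. 1 \<le> n \<and> \<beta> * 2 * (q ^ n / (1 - q)) \<le> a - \<beta>"
    using eventually_ge_at_top[of 1] by eventually_elim simp
  then obtain N where "N \<ge> 1" and N: "\<beta> * 2 * (q ^ N / (1 - q)) \<le> a - \<beta>"
    by (auto dest: eventually_happens)
  define r where "r m = \<alpha> * real m * log 2 (real a)" for m
  have r_pos: "r m > 0" if "m \<ge> N" for m
    using that \<open>N \<ge> 1\<close> assms(1,2) by (simp add: r_def)
  have powr_r: "2 powr r m = (q * \<beta>) ^ m" for m
  proof -
    have "2 powr r m = (2 powr log 2 a) powr (\<alpha> * m)"
      by (simp add: r_def powr_powr mult_ac)
    also have "\<dots> = (a powr \<alpha>) powr m"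
      using assms(1) by (simp add: powr_powr)
    also have "\<dots> = (q * \<beta>) ^ m"
      unfolding q\<beta> using assms(1) by (simp add: powr_realpow)
    finally show ?thesis .
  qed
  define simple where "simple t m = {u. ereal_of_enat (K u (string_of_nat t)) < ereal (r m)}" for t m
  \<comment> \<open>A pattern is forbidden when it is simple given every one of its positions, so
    avoiding it provides the required \<open>t\<close>.\<close>
  define B where "B = {(X, g). finite X \<and> N \<le> card X \<and> g \<in> X \<rightarrow>\<^sub>E {..<a} \<and>
    (\<forall>t\<in>X. encode_set_word X (subword g X) \<in> simple t (card X))}"
  let ?code = "\<lambda>(X, g). encode_set_word X (subword g X)"
  have "\<exists>\<omega>. (\<forall>i. \<omega> i \<in> {..<a}) \<and> (\<forall>X. finite X \<longrightarrow> (X, restrict \<omega> X) \<notin> B)"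
  proof (rule avoiding_sequence)
    show "X \<noteq> {} \<and> g \<in> X \<rightarrow>\<^sub>E {..<a}" if "(X, g) \<in> B" for X g
      using that \<open>N \<ge> 1\<close> by (auto simp: B_def)
  next
    fix v :: nat and T :: "nat set" assume "finite T"
    define P where "P = {p \<in> B. v \<in> fst p \<and> fst p \<subseteq> T}"
    have Pm: "finite {p \<in> P. card (fst p) = m} \<and>
        card {p \<in> P. card (fst p) = m} \<le> 2 * (q * \<beta>) ^ m" if "m \<ge> N" for m
    proof -
      \<comment> \<open>A pattern in \<open>P\<close> has \<open>v\<close> among its positions, so
        it is simple given \<open>v\<close>; one condition therefore suffices for the count.\<close>
      note simple_bounds = card_simple_outputs[OF r_pos[OF that], of D "string_of_nat v", folded K]
      have inj: "inj_on ?code {p \<in> P. card (fst p) = m}"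
        by (rule inj_on_subset[OF inj_on_encode_pattern[of "{..<a}"]]) (auto simp: P_def B_def)
      have sub: "?code ` {p \<in> P. card (fst p) = m} \<subseteq> simple v m"
        by (auto simp: P_def B_def)
      have fin: "finite (simple v m)"
        using simple_bounds(1) by (simp add: simple_def)
      have "card {p \<in> P. card (fst p) = m} \<le> card (simple v m)"
        using card_inj_on_le[OF inj sub fin] .
      with simple_bounds(2) have "card {p \<in> P. card (fst p) = m} \<le> 2 * 2 powr r m"
        unfolding simple_def by linarith
      moreover have "finite {p \<in> P. card (fst p) = m}"
        using inj_on_finite[OF inj sub fin] .
      ultimately show ?thesis by (simp add: powr_r)
    qed
    have "(\<Sum>p\<in>P. \<beta> / \<beta> ^ card (fst p)) \<le> \<beta> * 2 * (q ^ N / (1 - q))"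
      using \<beta> q \<open>finite T\<close> Pm by (intro pattern_weight_le[where T = T]) (auto simp: P_def B_def)
    with N show "(\<Sum>p\<in>{p \<in> B. v \<in> fst p \<and> fst p \<subseteq> T}. \<beta> / \<beta> ^ card (fst p)) \<le> real (card {..<a}) - \<beta>"
      by (simp add: P_def)
  qed (use \<beta> in auto)
  then obtain \<omega> where \<omega>: "\<And>i. \<omega> i < a" "\<And>X. finite X \<Longrightarrow> (X, restrict \<omega> X) \<notin> B" by auto
  have "\<exists>t\<in>X. ereal_of_enat (K (encode_set_word X (subword \<omega> X)) (string_of_nat t)) \<ge> ereal (r (card X))"
    if "finite X" "card X \<ge> N" for X
    \<comment> \<open>The restriction of \<omega> to \<open>X\<close> meets all other requirements
      of \<open>B\<close>, so simplicity must fail for some \<open>t\<close> in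
      \<open>X\<close>.\<close>
    using \<omega>(2)[OF that(1)] that \<omega>(1)
    by (auto simp: B_def simple_def subword_restrict not_less)
  with \<omega>(1) show ?thesis unfolding r_def by blast
qed

end
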